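(* Let $p\equiv 1 \pmod 4$ be a prime and let $m\in\mathbb{Z}$ with $p\nmid m$. Let $s'(p)$ be the number of pairs $(i,j)$ of integers with $1\le i<j\le (p-1)/2$ and $\widetilde{mi^2}>\widetilde{mj^2}$. Let $X=\{(a,b)\in V\times V : a<b<\overline{a}<\overline{b}\}$. Then $s'(p)\equiv |X| \pmod 2$.
   Context: For an integer $x$, $\{x\}_p$ denotes the least nonnegative residue of $x$ modulo $p$, and $\widetilde{x}=p-\{x\}_p$ if $\{x\}_p>p/2$, while $\widetilde{x}=\{x\}_p$ if $\{x\}_p<p/2$. Let $t=\prod_{x=1}^{(p-1)/2}x$ (so $t^2\equiv -1\pmod p$). Let $V=\{x : 1\le x\le (p-1)/2,\ x<\widetilde{tx}\}$, and for $a\in V$ put $\overline{a}=\widetilde{ta}$. *)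

theory Defs
  imports "HOL-Number_Theory.Number_Theory"
begin

text \<open>
  Here \<open>x mod p\<close> is the least nonnegative residue of \<open>x\<close> modulo \<open>p > 0\<close>. For odd \<open>p\<close> a residue
  is never equal to \<open>p / 2\<close>, so the two branches are exactly residue above and below \<open>p / 2\<close>.
\<close>
definition fold_res :: "int \<Rightarrow> int \<Rightarrow> int" where
  "fold_res p x = (if 2 * (x mod p) > p then p - x mod p else x mod p)"

definition half_fact :: "int \<Rightarrow> int" where
  "half_fact p = (\<Prod>x = 1..(p - 1) div 2. x)"

definition partner :: "int \<Rightarrow> int \<Rightarrow> int" where
  "partner p a = fold_res p (half_fact p * a)"

definition V_set :: "int \<Rightarrow> int set" where
  "V_set p = {x. 1 \<le> x \<and> x \<le> (p - 1) div 2 \<and> x < fold_res p (half_fact p * x)}"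

definition X_set :: "int \<Rightarrow> (int \<times> int) set" where
  "X_set p = {(a, b). a \<in> V_set p \<and> b \<in> V_set p \<and>
                a < b \<and> b < partner p a \<and> partner p a < partner p b}"

definition inversion_count :: "int \<Rightarrow> int \<Rightarrow> nat" where
  "inversion_count m p = card {(i, j). 1 \<le> i \<and> i < j \<and> j \<le> (p - 1) div 2 \<and>
                                 fold_res p (m * i\<^sup>2) > fold_res p (m * j\<^sup>2)}"

end

theory Submission
  imports Defs
begin

text \<open>
  Since \<open>t\<^sup>2 \<equiv> -1\<close>, the map \<open>i \<mapsto> fold_res p (m * i\<^sup>2)\<close> takes the same value at \<open>i\<close> and \<open>j\<close> exactly when
  \<open>j\<close> is \<open>i\<close> or its partner, and the partner map is an involution without fixed points. The pairs
  \<open>(i, j)\<close> are therefore grouped by the two fibres \<open>{a, a'}\<close> and \<open>{b, b'}\<close> they meet, \<open>a < b\<close>. Whichever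
  fibre carries the larger value, the four pairs between them contain 0 or 4 inversions if
  \<open>a < a' < b < b'\<close>, exactly 2 if \<open>a < b < b' < a'\<close>, and 1 or 3 if \<open>a < b < a' < b'\<close>.
\<close>

section \<open>Inversions between the orbits of an involution\<close>

text \<open>As \<open>a\<close> is smallest, only the orders \<open>a < c < b < d\<close>,
  \<open>a < b < c < d\<close> and \<open>a < b < d < c\<close> remain. Swapping which fibre has the
  larger value complements the inversions within the four cross pairs; four being even, the parity
  depends on the order alone.\<close>

lemma odd_card_fibre_pair_iff:
  fixes f :: "int \<Rightarrow> int" and a b c d :: int
  assumes "a < b" "a < c" "b < d" "c \<noteq> b" "c \<noteq> d"
    and "f c = f a" "f d = f b" "f a \<noteq> f b"
  defines "F \<equiv> {(i, j). (i, j) \<in> {a, c} \<times> {b, d} \<union> {b, d} \<times> {a, c} \<and> i < j \<and> f i > f j}"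
  shows "odd (card F) \<longleftrightarrow> b < c \<and> c < d"
proof -
  \<comment> \<open>Lets the simplifier filter the explicit list of eight ordered pairs one by one,
    so that each cardinality is computed outright.\<close>
  have filter_insert: "{z \<in> insert x A. P z} = (if P x then insert x {z \<in> A. P z} else {z \<in> A. P z})"
    for P and x :: "int \<times> int" and A
    by auto
  have F: "F = {z \<in> {(a, b), (a, d), (c, b), (c, d), (b, a), (b, c), (d, a), (d, c)}.
                  fst z < snd z \<and> f (fst z) > f (snd z)}"
    unfolding F_def by auto
  have ord: "a < d" "\<not> b < a" "\<not> d < a" "a \<noteq> b" "a \<noteq> c" "b \<noteq> d"
    using assms(1-3) by auto
  consider "c < b" "c < d" "\<not> b < c" "\<not> d < c" | "b < c" "\<not> c < b" "c < d" "\<not> d < c"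
    | "b < c" "\<not> c < b" "d < c" "\<not> c < d"
    using assms(1-5) by linarith
  moreover consider "f a < f b" "\<not> f b < f a" | "f b < f a" "\<not> f a < f b"
    using assms(8) by linarith
  ultimately show ?thesis
    unfolding F filter_insert using ord assms(1-8) by cases (auto simp: card_insert_if)+
qed

text \<open>The arithmetic is reduced to an involution \<open>g\<close> without fixed points whose
  orbits are the fibres of \<open>f\<close>. \<open>V\<close> picks the smaller point of each orbit;
  the inversions split into blocks indexed by pairs from \<open>V\<close>, and the blocks of odd
  size are exactly the crossings.\<close>

lemma card_inversions_cong_card_crossings:
  fixes f g :: "int \<Rightarrow> int" and H :: "int set"
  assumes "finite H"
    and g_in: "\<And>x. x \<in> H \<Longrightarrow> g x \<in> H"
    and g_g: "\<And>x. x \<in> H \<Longrightarrow> g (g x) = x"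
    and g_ne: "\<And>x. x \<in> H \<Longrightarrow> g x \<noteq> x"
    and f_eq: "\<And>x y. x \<in> H \<Longrightarrow> y \<in> H \<Longrightarrow> f x = f y \<longleftrightarrow> y = x \<or> y = g x"
  defines "V \<equiv> {x \<in> H. x < g x}"
  shows "[card {(i, j). i \<in> H \<and> j \<in> H \<and> i < j \<and> f i > f j} =
          card {(a, b). a \<in> V \<and> b \<in> V \<and> a < b \<and> b < g a \<and> g a < g b}] (mod 2)"
proof -
  define I where "I = {(i, j). i \<in> H \<and> j \<in> H \<and> i < j \<and> f i > f j}"
  define P where "P = {(a, b). a \<in> V \<and> b \<in> V \<and> a < b}"
  define F where "F = (\<lambda>(a, b). {(i, j). (i, j) \<in> {a, g a} \<times> {b, g b} \<union> {b, g b} \<times> {a, g a} \<and>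
                          i < j \<and> f i > f j})"
  define r where "r x = min x (g x)" for x
  have V_H: "x \<in> H" "x < g x" if "x \<in> V" for x
    using that by (auto simp: V_def)
  have r_V: "r x \<in> V" if "x \<in> H" for x
    using that g_in[OF that] g_g[OF that] g_ne[OF that] by (auto simp: r_def V_def min_def)
  have r_cases: "x = r x \<or> x = g (r x)" if "x \<in> H" for x
    using g_g[OF that] by (auto simp: r_def min_def)
  have r_id: "r x = x" "r (g x) = x" if "x \<in> V" for x
    using V_H[OF that] g_g[of x] by (auto simp: r_def)
  have f_r: "f (r x) = f x" if "x \<in> H" for x
    using f_eq[of x "r x"] that g_in[OF that] by (auto simp: r_def min_def)
  have "finite V" using \<open>finite H\<close> by (simp add: V_def)
  have "P \<subseteq> V \<times> V" by (auto simp: P_def)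
  then have finP: "finite P" using \<open>finite V\<close> finite_subset by blast
  have finF: "finite (F q)" for q
  proof -
    obtain a b where q: "q = (a, b)" by force
    have "F q \<subseteq> {a, g a, b, g b} \<times> {a, g a, b, g b}" by (auto simp: F_def q)
    then show ?thesis by (rule finite_subset) auto
  qed
  \<comment> \<open>The block is recovered from any of its members through the orbit representatives
    \<open>r\<close>, so distinct blocks are disjoint.\<close>
  have F_r: "(min (r i) (r j), max (r i) (r j)) = q" if "(i, j) \<in> F q" "q \<in> P" for i j q
    using that r_id by (auto simp: F_def P_def)
  have disj: "F q \<inter> F q' = {}" if "q \<in> P" "q' \<in> P" "q \<noteq> q'" for q q'
    using F_r[of _ _ q] F_r[of _ _ q'] that by (metis disjoint_iff surj_pair)
  have "I = (\<Union>q\<in>P. F q)"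
  proof (intro equalityI subsetI)
    fix z assume "z \<in> I"
    then obtain i j where z: "z = (i, j)" and ij: "i \<in> H" "j \<in> H" "i < j" "f i > f j"
      by (auto simp: I_def)
    \<comment> \<open>An inversion has two different values, so it never lies inside one
      orbit.\<close>
    have ne: "r i \<noteq> r j" using f_r[of i] f_r[of j] ij by auto
    show "z \<in> (\<Union>q\<in>P. F q)"
    proof (cases "r i < r j")
      case True
      then have "(r i, r j) \<in> P" "z \<in> F (r i, r j)"
        using r_V ij r_cases[of i] r_cases[of j] by (auto simp: P_def F_def z)
      then show ?thesis by blast
    next
      case False
      then have "(r j, r i) \<in> P" "z \<in> F (r j, r i)"
        using ne r_V ij r_cases[of i] r_cases[of j] by (auto simp: P_def F_def z)
      then show ?thesis by blast
    qed
  next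
    fix z assume "z \<in> (\<Union>q\<in>P. F q)"
    then show "z \<in> I" using g_in V_H by (auto simp: I_def P_def F_def)
  qed
  then have "card I = (\<Sum>q\<in>P. card (F q))"
    using card_UN_disjoint[OF finP, of F] finF disj by simp
  moreover have "odd (card (F (a, b))) \<longleftrightarrow> b < g a \<and> g a < g b" if "(a, b) \<in> P" for a b
  proof -
    have ab: "a \<in> V" "b \<in> V" "a < b" using that by (auto simp: P_def)
    have "g a \<noteq> b" "g a \<noteq> g b"
      using ab r_id(1)[of b] r_id(2)[of a] r_id(2)[of b] by auto
    moreover have "f (g a) = f a" "f (g b) = f b"
      using ab V_H f_eq[of a "g a"] f_eq[of b "g b"] g_in by auto
    moreover have "f a \<noteq> f b"
      using ab V_H f_eq[of a b] calculation by auto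
    ultimately show ?thesis
      using odd_card_fibre_pair_iff[of a b "g a" "g b" f] ab V_H by (simp add: F_def)
  qed
  then have "{q \<in> P. odd (card (F q))} =
      {(a, b). a \<in> V \<and> b \<in> V \<and> a < b \<and> b < g a \<and> g a < g b}"
    by (auto simp: P_def)
  \<comment> \<open>A sum has the parity of the number of its odd terms.\<close>
  ultimately have "even (card I) \<longleftrightarrow>
      even (card {(a, b). a \<in> V \<and> b \<in> V \<and> a < b \<and> b < g a \<and> g a < g b})"
    using even_sum_iff[OF finP, of "\<lambda>q. card (F q)"] by simp
  moreover have "[x = y] (mod 2)" if "even x \<longleftrightarrow> even y" for x y :: nat
    using that unfolding cong_def by presburger
  ultimately show ?thesis
    unfolding I_def by blast
qed

section \<open>Wilson's theorem and a square root of -1\<close>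

text \<open>The top \<open>j\<close> factors \<open>q - 1, ..., q - j\<close> of the factorial are
  congruent to \<open>-1, ..., -j\<close>.\<close>

lemma fact_pred_cong_fact_mult:
  assumes "j < q"
  shows "[fact (q - 1) = (-1) ^ j * fact j * (fact (q - 1 - j) :: int)] (mod int q)"
  using assms
proof (induction j)
  case (Suc j)
  \<comment> \<open>\<open>Suc r\<close> is the next factor \<open>q - (j + 1)\<close> to be split
    off; \<open>Suc j < q\<close> keeps the subtraction on naturals exact.\<close>
  define r where "r = q - 2 - j"
  have q: "q - 1 - j = Suc r" "q - 1 - Suc j = r" "int q = int r + int j + 2"
    using Suc.prems by (auto simp: r_def)
  have "[int (Suc r) = - int (Suc j)] (mod int q)"
    by (simp add: cong_iff_dvd_diff q algebra_simps)
  then have "[(-1) ^ j * fact j * (int (Suc r) * fact r) =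
      (-1) ^ j * fact j * (- int (Suc j) * fact r)] (mod int q)"
    by (intro cong_mult cong_refl)
  moreover have "[fact (q - 1) = (-1) ^ j * fact j * (int (Suc r) * fact r)] (mod int q)"
    using Suc q by simp
  ultimately show ?case
    unfolding q(2) by (simp add: cong_def algebra_simps)
qed auto

text \<open>With \<open>q = 4 * k + 1\<close>, splitting off \<open>j = 2 * k\<close> factors leaves
  \<open>2 * k\<close> others, and the sign is +1 because \<open>j\<close> is even. So the square is
  \<open>fact (q - 1)\<close> modulo \<open>p\<close>, which is -1 by Wilson's theorem.\<close>

lemma half_fact_squared_cong:
  assumes "prime p" "[p = 1] (mod 4)"
  shows "[(half_fact p)\<^sup>2 = -1] (mod p)"
proof -
  define q where "q = nat p"
  have p: "p = int q" "prime q"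
    using assms(1) prime_gt_0_int[of p] by (auto simp: q_def)
  define k where "k = q div 4"
  have q: "q = 4 * k + 1"
  proof -
    have "int (q mod 4) = 1" using assms(2) by (simp add: p cong_def zmod_int)
    then show ?thesis unfolding k_def by presburger
  qed
  have "half_fact p = fact (2 * k)"
  proof -
    have "(\<Prod>x = 1..int n. x) = fact n" for n
      using prod.reindex[of int "{1..n}" "\<lambda>x. x"]
      by (simp add: fact_prod image_int_atLeastAtMost)
    from this[of "2 * k"] show ?thesis by (simp add: half_fact_def p q)
  qed
  moreover have "[fact (q - 1) = (fact (2 * k))\<^sup>2] (mod p)"
    using fact_pred_cong_fact_mult[of "2 * k" q] by (simp add: p q power2_eq_square)
  moreover have "[fact (q - 1) = -1] (mod p)"
    using wilson_theorem[OF p(2)] by (simp add: p)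
  ultimately show ?thesis
    by (simp add: cong_def)
qed

section \<open>Folded residues as representatives up to sign\<close>

text \<open>The uniqueness half: the residue of \<open>x\<close> is \<open>y\<close> or
  \<open>p - y\<close>, and the bound on \<open>y\<close> decides which branch of
  \<open>fold_res\<close> applies.\<close>

lemma fold_res_eqI:
  assumes "odd p" "0 \<le> y" "y \<le> (p - 1) div 2" "p dvd x - y \<or> p dvd x + y"
  shows "fold_res p x = y"
proof (cases "p dvd x - y")
  case True
  then have "x mod p = y mod p" by (simp add: mod_eq_dvd_iff)
  also have "\<dots> = y" using assms by auto
  finally show ?thesis using assms by (auto simp: fold_res_def)
next
  case False
  \<comment> \<open>For \<open>y = 0\<close> both divisibilities would coincide, against the case
    assumption; this makes \<open>p - y\<close> a genuine residue below \<open>p\<close>.\<close>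
  then have "y \<noteq> 0" "x mod p = (p - y) mod p"
    using assms(4) by (auto simp: mod_eq_dvd_iff algebra_simps dvd_diff_right_iff
        dest: dvd_diff[of p "x + y" p])
  moreover have "(p - y) mod p = p - y"
    using assms(2,3) \<open>y \<noteq> 0\<close> by (intro mod_pos_pos_trivial) auto
  ultimately show ?thesis using assms by (auto simp: fold_res_def)
qed

lemma fold_res_dvd: "p dvd x - fold_res p x \<or> p dvd x + fold_res p x"
proof -
  have "x = p * (x div p) + x mod p" by simp
  then have "x - x mod p = p * (x div p)" "x + (p - x mod p) = p * (x div p + 1)"
    by (auto simp: algebra_simps)
  then show ?thesis unfolding fold_res_def by (metis dvd_triv_left)
qed

lemma fold_res_bounds:
  assumes "odd p" "0 < p"
  shows "0 \<le> fold_res p x" "fold_res p x \<le> (p - 1) div 2"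
proof -
  define y where "y = x mod p"
  have "0 \<le> y" "y < p" using assms by (auto simp: y_def)
  then have "0 \<le> fold_res p x \<and> fold_res p x \<le> (p - 1) div 2"
    using \<open>odd p\<close> unfolding fold_res_def y_def[symmetric] by presburger
  then show "0 \<le> fold_res p x" "fold_res p x \<le> (p - 1) div 2" by auto
qed

text \<open>Both arguments agree up to sign with their folded residues, and such a representative in
  the lower half is unique. Equality of folded values thus becomes divisibility, where primality of
  \<open>p\<close> can act.\<close>

lemma fold_res_eq_iff:
  assumes "odd p" "0 < p"
  shows "fold_res p x = fold_res p y \<longleftrightarrow> p dvd x - y \<or> p dvd x + y"
proof
  assume "fold_res p x = fold_res p y"
  then show "p dvd x - y \<or> p dvd x + y"
    using fold_res_dvd[of p x] fold_res_dvd[of p y]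
      dvd_diff[of p "x - fold_res p x" "y - fold_res p x"]
      dvd_add[of p "x - fold_res p x" "y + fold_res p x"]
      dvd_add[of p "x + fold_res p x" "y - fold_res p x"]
      dvd_diff[of p "x + fold_res p x" "y + fold_res p x"]
    by (auto simp: algebra_simps)
next
  define z where "z = fold_res p y"
  assume "p dvd x - y \<or> p dvd x + y"
  then have "p dvd x - z \<or> p dvd x + z"
    using fold_res_dvd[of p y, folded z_def]
      dvd_add[of p "x - y" "y - z"] dvd_add[of p "x - y" "y + z"]
      dvd_diff[of p "x + y" "y - z"] dvd_diff[of p "x + y" "y + z"]
    by (auto simp: algebra_simps)
  then show "fold_res p x = fold_res p y"
    using fold_res_eqI[of p z x] fold_res_bounds[of p y] assms by (auto simp: z_def)
qed

section \<open>The partner involution and the fibres of the folded squares\<close>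

theorem theorem2p1:
  fixes p m :: int
  assumes "prime p" and "[p = 1] (mod 4)" and "\<not> p dvd m"
  shows "[inversion_count m p = card (X_set p)] (mod 2)"
proof -
  define t where "t = half_fact p"
  define H where "H = {1..(p - 1) div 2}"
  define f where "f i = fold_res p (m * i\<^sup>2)" for i
  have "odd p" using assms(2) unfolding cong_def by presburger
  have "p > 1" using assms(1) by (rule prime_gt_1_int)
  note odd_pos = \<open>odd p\<close> order.strict_trans[OF zero_less_one \<open>p > 1\<close>]
  have "p > 2" using \<open>odd p\<close> \<open>p > 1\<close> by (cases "p = 2") auto
  have t: "p dvd t\<^sup>2 + 1"
    using half_fact_squared_cong[OF assms(1,2)] by (simp add: t_def cong_iff_dvd_diff)
  have prime_mult: "p dvd x * y \<longleftrightarrow> p dvd x \<or> p dvd y" for x y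
    using assms(1) by (rule prime_dvd_mult_iff)
  have "\<not> p dvd 2" using \<open>p > 2\<close> zdvd_not_zless by auto
  have not_dvd: "\<not> p dvd x" if "x \<in> H" for x
    using that \<open>p > 1\<close> by (intro zdvd_not_zless) (auto simp: H_def)
  have "\<not> p dvd t"
  proof
    assume "p dvd t"
    then have "p dvd t\<^sup>2" by (simp add: power2_eq_square)
    then have "p dvd 1" using t dvd_add_right_iff by blast
    then show False using \<open>p > 1\<close> by simp
  qed
  \<comment> \<open>\<open>t\<close> is not congruent to 1 or -1: otherwise \<open>p\<close> would
    divide \<open>(t^2 + 1) - (t^2 - 1) = 2\<close>. This will exclude fixed points of the partner
    map.\<close>
  have t_ne: "\<not> p dvd (t - 1) * (t + 1)"
  proof
    assume "p dvd (t - 1) * (t + 1)"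
    then have "p dvd (t\<^sup>2 + 1) - (t - 1) * (t + 1)" using t by (rule dvd_diff[rotated])
    then show False using \<open>\<not> p dvd 2\<close> by (simp add: algebra_simps power2_eq_square)
  qed
  have fold_H: "fold_res p x = x" if "x \<in> H" for x
    using that \<open>odd p\<close> by (intro fold_res_eqI) (auto simp: H_def)
  have partner_dvd: "p dvd t * x - partner p x \<or> p dvd t * x + partner p x" for x
    using fold_res_dvd[of p "t * x"] by (simp add: partner_def t_def)
  have partner_H: "partner p x \<in> H" if "x \<in> H" for x
  proof -
    have "partner p x \<noteq> 0"
      using partner_dvd[of x] \<open>\<not> p dvd t\<close> not_dvd[OF that] by (auto simp: prime_mult)
    then show ?thesis
      using fold_res_bounds[OF odd_pos, of "t * x"] by (auto simp: H_def partner_def t_def)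
  qed
  have partner_eq_iff: "y = partner p x \<longleftrightarrow> p dvd t * x - y \<or> p dvd t * x + y" if "y \<in> H" for x y
    using fold_res_eq_iff[OF odd_pos, of "t * x" y] fold_H[OF that]
    by (auto simp: partner_def t_def)
  \<comment> \<open>Multiplying by \<open>t\<close> twice gives \<open>-x\<close> modulo
    \<open>p\<close>, and folding forgets the sign.\<close>
  have partner_partner: "partner p (partner p x) = x" if "x \<in> H" for x
  proof -
    have "p dvd t * (t * x - partner p x) \<or> p dvd t * (t * x + partner p x)"
      using partner_dvd[of x] by auto
    moreover have "p dvd (t\<^sup>2 + 1) * x" using t by simp
    ultimately have "p dvd (t\<^sup>2 + 1) * x - t * (t * x - partner p x) \<or>
        p dvd t * (t * x + partner p x) - (t\<^sup>2 + 1) * x"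
      using dvd_diff by blast
    then have "p dvd t * partner p x + x \<or> p dvd t * partner p x - x"
      by (simp add: algebra_simps power2_eq_square)
    then show ?thesis using partner_eq_iff[OF that, of "partner p x"] by auto
  qed
  have partner_ne: "partner p x \<noteq> x" if "x \<in> H" for x
  proof
    assume "partner p x = x"
    then have "p dvd (t - 1) * x \<or> p dvd (t + 1) * x"
      using partner_dvd[of x] by (auto simp: algebra_simps)
    then show False using t_ne not_dvd[OF that] by (auto simp: prime_mult)
  qed
  have f_eq: "f x = f y \<longleftrightarrow> y = x \<or> y = partner p x" if "x \<in> H" "y \<in> H" for x y
  proof -
    have "f x = f y \<longleftrightarrow> p dvd m * (x\<^sup>2 - y\<^sup>2) \<or> p dvd m * (x\<^sup>2 + y\<^sup>2)"
      unfolding f_def fold_res_eq_iff[OF odd_pos] by (simp add: algebra_simps)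
    also have "\<dots> \<longleftrightarrow> p dvd x\<^sup>2 - y\<^sup>2 \<or> p dvd x\<^sup>2 + y\<^sup>2"
      using assms(3) by (simp add: prime_mult)
    also have "p dvd x\<^sup>2 - y\<^sup>2 \<longleftrightarrow> p dvd x - y \<or> p dvd x + y"
      by (simp add: prime_mult square_diff_square_factored power2_eq_square disj_commute)
    also have "\<dots> \<longleftrightarrow> y = x"
      using fold_res_eq_iff[OF odd_pos, of x y] fold_H that by auto
    \<comment> \<open>Subtracting from a multiple of \<open>t^2 + 1\<close> turns the sum of squares
      into the difference \<open>(t * x)^2 - y^2\<close>, whose two factors express the partner
      relation.\<close>
    also have "p dvd x\<^sup>2 + y\<^sup>2 \<longleftrightarrow> p dvd (t\<^sup>2 + 1) * x\<^sup>2 - (x\<^sup>2 + y\<^sup>2)"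
      using t by (simp add: dvd_diff_right_iff)
    also have "(t\<^sup>2 + 1) * x\<^sup>2 - (x\<^sup>2 + y\<^sup>2) = (t * x - y) * (t * x + y)"
      by (simp add: algebra_simps power2_eq_square)
    also have "p dvd \<dots> \<longleftrightarrow> y = partner p x"
      using partner_eq_iff[OF that(2), of x] by (simp add: prime_mult)
    finally show ?thesis .
  qed
  have "[card {(i, j). i \<in> H \<and> j \<in> H \<and> i < j \<and> f i > f j} =
      card {(a, b). a \<in> {x \<in> H. x < partner p x} \<and> b \<in> {x \<in> H. x < partner p x} \<and>
              a < b \<and> b < partner p a \<and> partner p a < partner p b}] (mod 2)"
    by (rule card_inversions_cong_card_crossings)
      (use partner_H partner_partner partner_ne f_eq in \<open>auto simp: H_def\<close>)
  moreover have "{(i, j). i \<in> H \<and> j \<in> H \<and> i < j \<and> f i > f j} =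
      {(i, j). 1 \<le> i \<and> i < j \<and> j \<le> (p - 1) div 2 \<and>
         fold_res p (m * i\<^sup>2) > fold_res p (m * j\<^sup>2)}"
    by (auto simp: H_def f_def)
  moreover have "{x \<in> H. x < partner p x} = V_set p"
    by (auto simp: H_def V_set_def partner_def)
  ultimately show ?thesis
    by (simp add: inversion_count_def X_set_def)
qed

end
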